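(* Let $A=U|A|\in\mathcal{B}(\mathcal{H})$ with $U$ unitary, and let $B\in\mathcal{B}(\mathcal{H})$ be such that $|A|BU=BU|A|$. Then the following hold: (1) If $UB$ is hyponormal, then $AB$ is hyponormal. (2) If $BU$ is hyponormal, then $BA$ is hyponormal. (3) If $UB$ is quasihyponormal, then $AB$ is quasihyponormal. (4) If $BU$ is quasihyponormal, then $BA$ is quasihyponormal.
   Context: $\mathcal{H}$ is a complex Hilbert space, $\mathcal{B}(\mathcal{H})$ is the set of bounded linear operators on $\mathcal{H}$, and $|A|=(A^*A)^{1/2}$. An operator $T\in\mathcal{B}(\mathcal{H})$ is hyponormal if $T^*T\geq TT^*$ (equivalently $\|Tx\|\geq\|T^*x\|$ for all $x\in\mathcal{H}$), and quasihyponormal if $T^{*2}T^2\geq (T^*T)^2$ (equivalently $\|T^2x\|\geq\|T^*Tx\|$ for all $x\in\mathcal{H}$). *)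

theory Defs
  imports "HOL-Analysis.Analysis"
begin

text \<open>Complex inner product spaces refine \<open>real_inner\<close>: the real inner product is the real part
  of the complex one, so the norm is \<open>sqrt (Re (cinner x x))\<close> and \<open>cinner\<close> is positive definite by
  the axioms of \<open>real_inner\<close>. It is linear in the first and antilinear in the second argument.\<close>

class complex_inner = real_inner +
  fixes scaleC :: "complex \<Rightarrow> 'a \<Rightarrow> 'a"  (infixr "*\<^sub>C" 75)
    and cinner :: "'a \<Rightarrow> 'a \<Rightarrow> complex"
  assumes scaleC_add_right: "c *\<^sub>C (x + y) = c *\<^sub>C x + c *\<^sub>C y"
    and scaleC_add_left: "(c + d) *\<^sub>C x = c *\<^sub>C x + d *\<^sub>C x"
    and scaleC_scaleC: "c *\<^sub>C d *\<^sub>C x = (c * d) *\<^sub>C x"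
    and scaleR_scaleC: "r *\<^sub>R x = complex_of_real r *\<^sub>C x"
    and cinner_commute: "cinner x y = cnj (cinner y x)"
    and cinner_add_left: "cinner (x + y) z = cinner x z + cinner y z"
    and cinner_scaleC_left: "cinner (c *\<^sub>C x) y = c * cinner x y"
    and inner_eq_Re_cinner: "inner x y = Re (cinner x y)"

class chilbert_space = complex_inner + complete_space

definition bounded_clinear :: "('a::complex_inner \<Rightarrow> 'a) \<Rightarrow> bool" where
  "bounded_clinear T \<longleftrightarrow> bounded_linear T \<and> (\<forall>c x. T (c *\<^sub>C x) = c *\<^sub>C T x)"

text \<open>For bounded \<open>T\<close> on a Hilbert space the described operator exists and is unique, by the Riesz
  representation theorem.\<close>

definition hilbert_adjoint :: "('a::chilbert_space \<Rightarrow> 'a) \<Rightarrow> 'a \<Rightarrow> 'a" where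
  "hilbert_adjoint T = (THE S. \<forall>x y. cinner (T x) y = cinner x (S y))"

definition unitary_op :: "('a::chilbert_space \<Rightarrow> 'a) \<Rightarrow> bool" where
  "unitary_op U \<longleftrightarrow>
     bounded_clinear U \<and> hilbert_adjoint U \<circ> U = id \<and> U \<circ> hilbert_adjoint U = id"

text \<open>Membership in \<open>\<real>\<^sub>\<ge>\<^sub>0\<close> says that the value is real and nonnegative.\<close>

definition positive_op :: "('a::chilbert_space \<Rightarrow> 'a) \<Rightarrow> bool" where
  "positive_op T \<longleftrightarrow> bounded_clinear T \<and> (\<forall>x. cinner (T x) x \<in> \<real>\<^sub>\<ge>\<^sub>0)"

definition op_le :: "('a::chilbert_space \<Rightarrow> 'a) \<Rightarrow> ('a \<Rightarrow> 'a) \<Rightarrow> bool" where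
  "op_le S T \<longleftrightarrow> positive_op (\<lambda>x. T x - S x)"

text \<open>A positive operator has exactly one positive square root.\<close>

definition op_sqrt :: "('a::chilbert_space \<Rightarrow> 'a) \<Rightarrow> 'a \<Rightarrow> 'a" where
  "op_sqrt T = (THE P. positive_op P \<and> P \<circ> P = T)"

definition op_abs :: "('a::chilbert_space \<Rightarrow> 'a) \<Rightarrow> 'a \<Rightarrow> 'a" where
  "op_abs A = op_sqrt (hilbert_adjoint A \<circ> A)"

definition hyponormal :: "('a::chilbert_space \<Rightarrow> 'a) \<Rightarrow> bool" where
  "hyponormal T \<longleftrightarrow>
     bounded_clinear T \<and> op_le (T \<circ> hilbert_adjoint T) (hilbert_adjoint T \<circ> T)"

definition quasihyponormal :: "('a::chilbert_space \<Rightarrow> 'a) \<Rightarrow> bool" where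
  "quasihyponormal T \<longleftrightarrow>
     bounded_clinear T \<and>
     op_le ((hilbert_adjoint T \<circ> T) ^^ 2) ((hilbert_adjoint T ^^ 2) \<circ> (T ^^ 2))"

end

theory Submission imports Defs begin

text \<open>
  Put \<open>P = |A|\<close> and \<open>C = BU\<close>, so that \<open>PC = CP\<close> by hypothesis. From \<open>A = UP\<close> one reads off
  \<open>BA = CP\<close>, \<open>AB = U(CP)U\<^sup>*\<close> and \<open>UB = UCU\<^sup>*\<close>. Hyponormality and quasihyponormality are
  invariant under unitary conjugation (\<open>hyponormal_unitary_conj\<close>,
  \<open>quasihyponormal_unitary_conj\<close>), so all four claims reduce to one: each of the two properties
  passes from \<open>C\<close> to \<open>CP\<close> when \<open>P\<close> is positive and commutes with \<open>C\<close>.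

  For this, rewrite hyponormality of \<open>T\<close> as \<open>\<parallel>T\<^sup>*x\<parallel> \<le> \<parallel>Tx\<parallel>\<close> and quasihyponormality as
  \<open>\<parallel>T\<^sup>*Tx\<parallel> \<le> \<parallel>T\<^sup>2x\<parallel>\<close>. Since \<open>P\<close> is selfadjoint it also commutes with \<open>C\<^sup>*\<close>, hence
  \<open>(CP)\<^sup>* = C\<^sup>*P\<close>, and the inequality for \<open>CP\<close> at \<open>x\<close> is the one for \<open>C\<close> at \<open>Px\<close>, respectively
  at \<open>P\<^sup>2x\<close>.

  The analytic part is to know that the adjoint and \<open>|A|\<close>, both given by definite descriptions,
  have their characteristic properties. Adjoints come from the Riesz representation theorem. The
  square root of a positive operator is the norm limit of a quadratic iteration
  (\<open>ex_positive_sqrt\<close>); it commutes with everything that commutes with the operator, which makes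
  it commute with any other positive square root and so forces uniqueness.

  A complex-linear operator is determined by the real parts of its inner products: symmetry and
  adjointness for the real inner product imply them for the complex one. Most arguments therefore
  use the real inner product alone.
\<close>

section \<open>Complex inner products and their real parts\<close>

instance chilbert_space \<subseteq> banach ..

lemma cinner_eq_Complex: "cinner x y = Complex (inner x y) (inner x (\<i> *\<^sub>C y))"
proof -
  have "cinner x (\<i> *\<^sub>C y) = - \<i> * cinner x y"
    by (subst (1 2) cinner_commute) (simp add: cinner_scaleC_left)
  then show ?thesis
    by (simp add: complex_eq_iff inner_eq_Re_cinner)
qed

lemma inner_scaleC_left: "inner (c *\<^sub>C x) y = inner x (cnj c *\<^sub>C y)"
proof -
  have "cinner (c *\<^sub>C x) y = cinner x (cnj c *\<^sub>C y)"
    by (subst (2) cinner_commute) (simp add: cinner_scaleC_left cinner_commute[of x y])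
  then show ?thesis by (simp add: inner_eq_Re_cinner)
qed

lemma norm_scaleC: "norm (c *\<^sub>C (x::'a::complex_inner)) = cmod c * norm x"
proof -
  have "inner (c *\<^sub>C x) (c *\<^sub>C x) = inner x (complex_of_real ((cmod c)\<^sup>2) *\<^sub>C x)"
    by (simp only: inner_scaleC_left scaleC_scaleC complex_norm_square mult.commute)
  also have "\<dots> = (cmod c)\<^sup>2 * inner x x"
    by (simp only: scaleR_scaleC[symmetric] inner_scaleR_right)
  finally show ?thesis
    by (simp add: norm_eq_sqrt_inner real_sqrt_mult)
qed

lemma bounded_linear_scaleC: "bounded_linear (\<lambda>x::'a::complex_inner. c *\<^sub>C x)"
proof (rule bounded_linear_intro[where K = "cmod c"])
  show "c *\<^sub>C (r *\<^sub>R x) = r *\<^sub>R (c *\<^sub>C x)" for r and x :: 'a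
    by (simp add: scaleR_scaleC scaleC_scaleC mult.commute)
qed (simp_all add: scaleC_add_right norm_scaleC)

lemma scaleC_diff_right: "c *\<^sub>C (x - y) = c *\<^sub>C x - c *\<^sub>C (y::'a::complex_inner)"
  by (rule linear_diff[OF bounded_linear.linear[OF bounded_linear_scaleC]])

lemma bounded_clinear_bounded_linear: "bounded_clinear T \<Longrightarrow> bounded_linear T"
  by (simp add: bounded_clinear_def)

lemma bounded_clinear_scaleC: "bounded_clinear T \<Longrightarrow> T (c *\<^sub>C x) = c *\<^sub>C T x"
  by (simp add: bounded_clinear_def)

lemma bounded_clinear_comp:
  "bounded_clinear S \<Longrightarrow> bounded_clinear T \<Longrightarrow> bounded_clinear (S \<circ> T)"
  by (auto simp: bounded_clinear_def o_def intro: bounded_linear_compose)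

lemma bounded_clinear_diff:
  assumes "bounded_clinear S" "bounded_clinear T"
  shows "bounded_clinear (\<lambda>x. S x - T x)"
  using assms bounded_linear_scaleC
  by (auto simp: bounded_clinear_def bounded_linear_sub linear_diff bounded_linear.linear scaleC_diff_right)

text \<open>Replacing \<open>x\<close> by \<open>-\<i>x\<close> turns the real part of a complex inner product into its imaginary part;
  complex linearity of \<open>T\<close> is what makes this substitution pass through \<open>T\<close>.\<close>

lemma cinner_adjoint_if_inner_adjoint:
  assumes T: "bounded_clinear T" and adj: "\<And>x y. inner (T x) y = inner x (S y)"
  shows "cinner (T x) y = cinner x (S y)"
proof -
  have "inner (T x) (\<i> *\<^sub>C y) = inner (T (- \<i> *\<^sub>C x)) y"
    by (simp add: bounded_clinear_scaleC[OF T] inner_scaleC_left)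
  also have "\<dots> = inner x (\<i> *\<^sub>C S y)"
    by (simp add: adj inner_scaleC_left)
  finally show ?thesis
    by (simp add: cinner_eq_Complex adj)
qed

section \<open>The Riesz representation theorem and adjoints\<close>

text \<open>Taking \<open>p = 0\<close> yields \<open>a = 0\<close>, the first-order condition at a minimum; taking values of a
  quadratic form yields the Cauchy-Schwarz inequality.\<close>

lemma quadratic_nonneg_discriminant:
  fixes p a c :: real
  assumes nonneg: "\<And>t. 0 \<le> p + 2 * t * a + t\<^sup>2 * c" and "0 \<le> c"
  shows "a\<^sup>2 \<le> p * c"
proof (cases "c = 0")
  case True
  have "a = 0"
  proof (rule ccontr)
    assume "a \<noteq> 0"
    then show False
      using nonneg[of "- (p + 1) / (2 * a)"] True by (simp add: field_simps)
  qed
  then show ?thesis using True by simp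
next
  case False
  then have "0 < c" using \<open>0 \<le> c\<close> by simp
  have "0 \<le> p - a\<^sup>2 / c"
    using nonneg[of "- a / c"] \<open>0 < c\<close> by (simp add: power2_eq_square field_simps)
  then show ?thesis
    using \<open>0 < c\<close> by (simp add: field_simps)
qed

text \<open>The representing vector is the minimiser of \<open>\<parallel>x\<parallel>\<^sup>2 - 2 f x\<close>, which equals \<open>\<parallel>x - z\<parallel>\<^sup>2 - \<parallel>z\<parallel>\<^sup>2\<close>
  once \<open>z\<close> represents \<open>f\<close>. The parallelogram law makes minimising sequences Cauchy, and the
  first-order condition at the limit is the representation.\<close>

theorem riesz_representation:
  fixes f :: "'a::{real_inner,complete_space} \<Rightarrow> real"
  assumes f: "bounded_linear f"
  shows "\<exists>z. \<forall>x. f x = inner z x"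
proof -
  interpret f: bounded_linear f by (rule f)
  define g where "g x = (norm x)\<^sup>2 - 2 * f x" for x
  obtain K where K: "\<And>x. \<bar>f x\<bar> \<le> norm x * K"
    using f.bounded by auto
  have "- K\<^sup>2 \<le> g x" for x
  proof -
    have "0 \<le> (norm x - K)\<^sup>2" by simp
    also have "\<dots> \<le> g x + K\<^sup>2"
      using K[of x] by (simp add: g_def power2_diff mult.commute)
    finally show ?thesis by simp
  qed
  then have bdd: "bdd_below (range g)" by (meson bdd_belowI2)
  define m where "m = (INF x. g x)"
  have m_le: "m \<le> g x" for x
    unfolding m_def by (rule cINF_lower[OF bdd]) simp
  have "\<exists>x. g x < m + 1 / Suc n" for n
    using cINF_less_iff[OF _ bdd, of "m + 1 / Suc n"] by (auto simp: m_def)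
  then obtain X where X: "\<And>n. g (X n) < m + 1 / Suc n" by metis
  \<comment> \<open>The linear parts of \<open>g\<close> cancel, leaving the parallelogram law.\<close>
  have parallelogram: "g x + g y = 2 * g ((1/2) *\<^sub>R (x + y)) + (norm (x - y))\<^sup>2 / 2" for x y
    by (simp add: g_def f.scaleR f.add power2_norm_eq_inner inner_simps inner_commute
        field_simps)
  have X_close: "(norm (X i - X j))\<^sup>2 \<le> 4 / Suc N" if "N \<le> i" "N \<le> j" for i j N
  proof -
    have "1 / Suc i \<le> 1 / Suc N" "1 / Suc j \<le> 1 / Suc N"
      using that by (auto intro!: frac_le)
    then show ?thesis
      using parallelogram[of "X i" "X j"] m_le[of "(1/2) *\<^sub>R (X i + X j)"] X[of i] X[of j]
      by linarith
  qed
  have "Cauchy X"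
  proof (rule metric_CauchyI)
    fix e :: real assume "0 < e"
    then obtain N where "4 / e\<^sup>2 < Suc N"
      using reals_Archimedean2 less_Suc_eq by (metis of_nat_less_iff order_less_trans)
    then have N: "4 / Suc N < e\<^sup>2" using \<open>0 < e\<close> by (simp add: field_simps)
    have "dist (X i) (X j) < e" if "N \<le> i" "N \<le> j" for i j
      using X_close[OF that] N \<open>0 < e\<close> unfolding dist_norm
      by (intro power2_less_imp_less[of _ e]) auto
    then show "\<exists>M. \<forall>i\<ge>M. \<forall>j\<ge>M. dist (X i) (X j) < e" by blast
  qed
  then obtain z where z: "X \<longlonglongrightarrow> z"
    using Cauchy_convergent convergent_def by blast
  have "(\<lambda>n. g (X n)) \<longlonglongrightarrow> g z"
    unfolding g_def by (intro tendsto_intros f.tendsto z)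
  moreover have "(\<lambda>n. m + 1 / Suc n) \<longlonglongrightarrow> m + 0"
    by (intro tendsto_intros LIMSEQ_Suc lim_1_over_n)
  ultimately have "g z \<le> m"
    using X by (auto intro: LIMSEQ_le less_imp_le)
  then have min: "g z \<le> g x" for x using m_le[of x] by simp
  have "f x = inner z x" for x
  proof -
    have "(inner z x - f x)\<^sup>2 \<le> 0 * (norm x)\<^sup>2"
    proof (rule quadratic_nonneg_discriminant)
      show "0 \<le> 0 + 2 * t * (inner z x - f x) + t\<^sup>2 * (norm x)\<^sup>2" for t
        using min[of "z + t *\<^sub>R x"] unfolding g_def power2_norm_eq_inner
        by (simp add: f.scaleR f.add inner_simps inner_commute[of x z]
            power2_eq_square algebra_simps)
    qed simp
    then show ?thesis by simp
  qed
  then show ?thesis by blast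
qed

lemma hilbert_adjoint_eqI:
  assumes "\<And>x y. cinner (T x) y = cinner x (S y)"
  shows "hilbert_adjoint T = S"
  unfolding hilbert_adjoint_def
proof (rule the_equality)
  fix S' assume "\<forall>x y. cinner (T x) y = cinner x (S' y)"
  then have "inner x (S' y) = inner x (S y)" for x y
    using assms by (simp add: inner_eq_Re_cinner)
  then show "S' = S"
    by (metis ext vector_eq_ldot)
qed (simp add: assms)

lemma cinner_hilbert_adjoint:
  assumes T: "bounded_clinear T"
  shows "cinner (T x) y = cinner x (hilbert_adjoint T y)"
proof -
  have "\<exists>z. \<forall>x. inner (T x) y = inner z x" for y
    by (intro riesz_representation bounded_linear_inner_left_comp
        bounded_clinear_bounded_linear[OF T])
  then obtain S where "\<And>x y. inner (T x) y = inner x (S y)"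
    by (metis inner_commute)
  note adj = cinner_adjoint_if_inner_adjoint[OF T this]
  with hilbert_adjoint_eqI[OF adj] show ?thesis by simp
qed

lemma inner_hilbert_adjoint:
  "bounded_clinear T \<Longrightarrow> inner (T x) y = inner x (hilbert_adjoint T y)"
  by (simp add: inner_eq_Re_cinner cinner_hilbert_adjoint)

lemma inner_hilbert_adjoint_left:
  "bounded_clinear T \<Longrightarrow> inner (hilbert_adjoint T x) y = inner x (T y)"
  by (metis inner_commute inner_hilbert_adjoint)

lemma hilbert_adjoint_inner_eqI:
  assumes "bounded_clinear T" "\<And>x y. inner (T x) y = inner x (S y)"
  shows "hilbert_adjoint T = S"
  by (intro hilbert_adjoint_eqI cinner_adjoint_if_inner_adjoint assms)

lemma bounded_clinear_hilbert_adjoint: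
  assumes T: "bounded_clinear T"
  shows "bounded_clinear (hilbert_adjoint T)"
proof -
  let ?S = "hilbert_adjoint T"
  note adj = inner_hilbert_adjoint[OF T, symmetric]
  have add: "?S (x + y) = ?S x + ?S y" for x y
    by (rule vector_eq_ldot[THEN iffD1]) (simp add: adj inner_add_right)
  have scale: "?S (c *\<^sub>C x) = c *\<^sub>C ?S x" for c x
  proof (rule vector_eq_ldot[THEN iffD1], rule allI)
    fix z
    have "inner z (c *\<^sub>C ?S x) = inner (cnj c *\<^sub>C z) (?S x)"
      by (simp add: inner_scaleC_left)
    then show "inner z (?S (c *\<^sub>C x)) = inner z (c *\<^sub>C ?S x)"
      by (simp add: adj bounded_clinear_scaleC[OF T] inner_scaleC_left)
  qed
  obtain K where K: "\<And>x. norm (T x) \<le> norm x * K" "0 \<le> K"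
    using bounded_linear.nonneg_bounded[OF bounded_clinear_bounded_linear[OF T]] by blast
  have "norm (?S y) \<le> norm y * K" for y
  proof (cases "?S y = 0")
    case False
    have "norm (?S y) * norm (?S y) = inner (T (?S y)) y"
      by (simp add: adj[symmetric] norm_eq_sqrt_inner)
    also have "\<dots> \<le> norm (T (?S y)) * norm y" by (rule norm_cauchy_schwarz)
    also have "\<dots> \<le> norm (?S y) * (norm y * K)"
      using mult_right_mono[OF K(1)[of "?S y"], of "norm y"] by (simp add: mult_ac)
    finally show ?thesis using False by simp
  qed (simp add: K(2))
  then have "bounded_linear ?S"
    by (intro bounded_linear_intro[of _ K]) (simp_all add: add scale scaleR_scaleC)
  then show ?thesis
    by (simp add: bounded_clinear_def scale)
qed

lemma hilbert_adjoint_comp: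
  assumes "bounded_clinear S" "bounded_clinear T"
  shows "hilbert_adjoint (S \<circ> T) = hilbert_adjoint T \<circ> hilbert_adjoint S"
  using assms by (intro hilbert_adjoint_eqI) (simp add: cinner_hilbert_adjoint)

lemma hilbert_adjoint_hilbert_adjoint:
  assumes "bounded_clinear T"
  shows "hilbert_adjoint (hilbert_adjoint T) = T"
  using assms
  by (intro hilbert_adjoint_inner_eqI bounded_clinear_hilbert_adjoint)
    (metis inner_commute inner_hilbert_adjoint)+

section \<open>Positive operators\<close>

lemma positive_op_bounded_clinear: "positive_op T \<Longrightarrow> bounded_clinear T"
  by (simp add: positive_op_def)

lemma positive_op_inner_nonneg: "positive_op T \<Longrightarrow> 0 \<le> inner (T x) x"
  by (auto simp: positive_op_def inner_eq_Re_cinner complex_nonneg_Reals_iff)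

text \<open>Positivity asks only that the quadratic form be real; symmetry follows because the scalars are
  complex. Expanding the vanishing imaginary part at \<open>x + \<i>y\<close> leaves exactly the difference of the
  two sides.\<close>

lemma positive_op_symmetric:
  assumes T: "positive_op T"
  shows "inner (T x) y = inner x (T y)"
proof -
  have lin: "bounded_clinear T" using T by (rule positive_op_bounded_clinear)
  have real: "inner (T x) (\<i> *\<^sub>C x) = 0" for x
    using T by (auto simp: positive_op_def cinner_eq_Complex complex_nonneg_Reals_iff)
  have i: "\<i> *\<^sub>C \<i> *\<^sub>C x = - x" "- \<i> *\<^sub>C \<i> *\<^sub>C x = x" for x :: 'a
    using scaleR_scaleC[of "-1" x] scaleR_scaleC[of 1 x] by (simp_all add: scaleC_scaleC)
  have "inner (T (x + \<i> *\<^sub>C y)) (\<i> *\<^sub>C (x + \<i> *\<^sub>C y))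
      = inner (T x) (\<i> *\<^sub>C x) + inner (T (\<i> *\<^sub>C y)) (\<i> *\<^sub>C \<i> *\<^sub>C y)
        - inner (T x) y + inner (T y) x"
    by (simp add: linear_add[OF bounded_linear.linear[OF bounded_clinear_bounded_linear[OF lin]]]
        bounded_clinear_scaleC[OF lin] scaleC_add_right inner_simps i inner_scaleC_left
        scaleC_scaleC[symmetric])
  then have "inner (T y) x = inner (T x) y"
    by (simp add: real)
  then show ?thesis by (simp add: inner_commute)
qed

lemma positive_opI:
  assumes T: "bounded_clinear T" and sym: "\<And>x y. inner (T x) y = inner x (T y)"
    and nonneg: "\<And>x. 0 \<le> inner (T x) x"
  shows "positive_op T"
proof -
  have "cinner (T x) x = cnj (cinner (T x) x)" for x
    by (subst cinner_adjoint_if_inner_adjoint[OF T sym]) (rule cinner_commute)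
  then have "Im (cinner (T x) x) = 0" for x
    by (metis Im_complex_of_real Reals_cnj_iff Reals_cases)
  then show ?thesis
    using T nonneg by (simp add: positive_op_def complex_nonneg_Reals_iff inner_eq_Re_cinner)
qed

lemma hilbert_adjoint_positive: "positive_op T \<Longrightarrow> hilbert_adjoint T = T"
  by (intro hilbert_adjoint_inner_eqI positive_op_bounded_clinear positive_op_symmetric)

lemma op_le_iff:
  assumes "bounded_clinear S" "bounded_clinear T"
    and "\<And>x y. inner (S x) y = inner x (S y)" "\<And>x y. inner (T x) y = inner x (T y)"
  shows "op_le S T \<longleftrightarrow> (\<forall>x. inner (S x) x \<le> inner (T x) x)"
proof -
  have "op_le S T \<longleftrightarrow> (\<forall>x. 0 \<le> inner (T x - S x) x)"
    unfolding op_le_def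
    using positive_op_inner_nonneg[of "\<lambda>x. T x - S x"]
      positive_opI[OF bounded_clinear_diff[OF assms(2,1)]]
    by (auto simp: inner_diff_left inner_diff_right assms(3,4))
  then show ?thesis by (simp add: inner_diff_left)
qed

text \<open>The form \<open>(x, y) \<mapsto> \<langle>Tx, y\<rangle>\<close> is a possibly degenerate inner product; the discriminant
  argument for the Cauchy-Schwarz inequality also covers vectors on which its quadratic form vanishes.\<close>

lemma symmetric_nonneg_cauchy_schwarz:
  fixes T :: "'a::real_inner \<Rightarrow> 'a"
  assumes T: "linear T" and sym: "\<And>x y. inner (T x) y = inner x (T y)"
    and nonneg: "\<And>x. 0 \<le> inner (T x) x"
  shows "(inner (T x) y)\<^sup>2 \<le> inner (T x) x * inner (T y) y"
proof (rule quadratic_nonneg_discriminant)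
  show "0 \<le> inner (T x) x + 2 * t * inner (T x) y + t\<^sup>2 * inner (T y) y" for t
    using nonneg[of "x + t *\<^sub>R y"] sym[of x y]
    by (simp add: linear_add[OF T] linear_scale[OF T] inner_simps inner_commute
        power2_eq_square algebra_simps)
qed (rule nonneg)

section \<open>The positive square root\<close>

interpretation blinfun_compose: bounded_bilinear "(o\<^sub>L)"
  by (rule bounded_bilinear_blinfun_compose)

text \<open>A fixed point \<open>X\<close> of this iteration satisfies \<open>(1 - X)\<^sup>2 = 1 - R\<close>, so the limit yields a square
  root of \<open>1 - R\<close>.\<close>

primrec sqrt_iter :: "('a::banach \<Rightarrow>\<^sub>L 'a) \<Rightarrow> nat \<Rightarrow> 'a \<Rightarrow>\<^sub>L 'a" where
  "sqrt_iter R 0 = 0"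
| "sqrt_iter R (Suc n) = (1/2) *\<^sub>R (R + (sqrt_iter R n o\<^sub>L sqrt_iter R n))"

text \<open>The same iteration for the number \<open>1\<close>. When \<open>\<parallel>R\<parallel> \<le> 1\<close> it dominates both the iterates and
  their increments, and being monotone and bounded it converges.\<close>

primrec sqrt_majorant :: "nat \<Rightarrow> real" where
  "sqrt_majorant 0 = 0"
| "sqrt_majorant (Suc n) = (1 + (sqrt_majorant n)\<^sup>2) / 2"

lemma sqrt_majorant_bounds: "0 \<le> sqrt_majorant n" "sqrt_majorant n \<le> 1"
proof (induction n)
  case (Suc n)
  case 1 show ?case by simp
  case 2 show ?case using Suc by (simp add: power_le_one)
qed simp_all

lemma sqrt_majorant_incseq: "incseq sqrt_majorant"
proof (rule incseq_SucI)
  show "sqrt_majorant n \<le> sqrt_majorant (Suc n)" for n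
    using zero_le_power2[of "1 - sqrt_majorant n"] by (simp add: power2_diff)
qed

lemma norm_sqrt_iter:
  assumes "norm R \<le> 1"
  shows "norm (sqrt_iter R n) \<le> sqrt_majorant n"
proof (induction n)
  case (Suc n)
  have "norm (sqrt_iter R n o\<^sub>L sqrt_iter R n) \<le> norm (sqrt_iter R n) * norm (sqrt_iter R n)"
    by (rule norm_blinfun_compose)
  also have "\<dots> \<le> (sqrt_majorant n)\<^sup>2"
    unfolding power2_eq_square using Suc by (intro mult_mono) (auto simp: sqrt_majorant_bounds)
  finally show ?case
    using assms norm_triangle_ineq[of R "sqrt_iter R n o\<^sub>L sqrt_iter R n"] by simp
qed simp

text \<open>The increment of the squares is split as \<open>Y\<^sup>2 - X\<^sup>2 = Y(Y - X) + (Y - X)X\<close>, an identity valid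
  without commutativity; its scalar counterpart is exact, so the domination reproduces itself.\<close>

lemma norm_sqrt_iter_step:
  assumes R: "norm R \<le> 1"
  shows "norm (sqrt_iter R (Suc n) - sqrt_iter R n) \<le> sqrt_majorant (Suc n) - sqrt_majorant n"
proof (induction n)
  case 0 then show ?case using R by simp
next
  case (Suc n)
  let ?Y = "sqrt_iter R (Suc n)" and ?X = "sqrt_iter R n"
  let ?s = "sqrt_majorant (Suc n)" and ?t = "sqrt_majorant n"
  have "sqrt_iter R (Suc (Suc n)) - ?Y = (1/2) *\<^sub>R ((?Y o\<^sub>L ?Y) - (?X o\<^sub>L ?X))"
    by (simp only: sqrt_iter.simps(2)[of R "Suc n"] sqrt_iter.simps(2)[of R n, symmetric])
      (simp add: scaleR_right_distrib scaleR_right_diff_distrib)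
  also have "(?Y o\<^sub>L ?Y) - (?X o\<^sub>L ?X) = (?Y o\<^sub>L (?Y - ?X)) + ((?Y - ?X) o\<^sub>L ?X)"
    by (simp only: blinfun_compose.diff_left blinfun_compose.diff_right) simp
  also have "norm ((1/2) *\<^sub>R \<dots>)
      \<le> (norm ?Y * norm (?Y - ?X) + norm (?Y - ?X) * norm ?X) / 2"
    using norm_triangle_ineq[of "?Y o\<^sub>L (?Y - ?X)" "(?Y - ?X) o\<^sub>L ?X"]
      norm_blinfun_compose[of ?Y "?Y - ?X"] norm_blinfun_compose[of "?Y - ?X" ?X]
    by (simp del: sqrt_iter.simps)
  also have "\<dots> \<le> (?s * (?s - ?t) + (?s - ?t) * ?t) / 2"
    using Suc norm_sqrt_iter[OF R, of "Suc n"] norm_sqrt_iter[OF R, of n]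
      sqrt_majorant_bounds[of n] sqrt_majorant_bounds[of "Suc n"]
      incseq_SucD[OF sqrt_majorant_incseq, of n]
    by (intro divide_right_mono add_mono mult_mono) (auto simp del: sqrt_iter.simps sqrt_majorant.simps)
  also have "\<dots> = sqrt_majorant (Suc (Suc n)) - ?s"
  proof -
    have *: "(s * (s - t) + (s - t) * t) / 2 = (1 + s\<^sup>2) / 2 - (1 + t\<^sup>2) / 2" for s t :: real
      by (simp add: power2_eq_square field_simps)
    show ?thesis by (subst *) simp
  qed
  finally show ?case .
qed

text \<open>Telescoping the increments bounds the distance of two iterates by that of the corresponding
  majorants, so the Cauchy property is inherited from a convergent real sequence.\<close>

lemma convergent_sqrt_iter:
  assumes R: "norm R \<le> 1"
  shows "convergent (sqrt_iter R)"
proof -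
  have le: "norm (sqrt_iter R m - sqrt_iter R n) \<le> sqrt_majorant m - sqrt_majorant n"
    if "n \<le> m" for m n
    using that
  proof (induction m rule: dec_induct)
    case (step m)
    then show ?case
      using norm_triangle_ineq[of "sqrt_iter R (Suc m) - sqrt_iter R m" "sqrt_iter R m - sqrt_iter R n"]
        norm_sqrt_iter_step[OF R, of m]
      by (simp del: sqrt_iter.simps sqrt_majorant.simps)
  qed simp
  have "convergent sqrt_majorant"
    using incseq_convergent[OF sqrt_majorant_incseq] sqrt_majorant_bounds(2) convergentI by metis
  then have C: "Cauchy sqrt_majorant" by (rule convergent_Cauchy)
  have "Cauchy (sqrt_iter R)"
  proof (rule metric_CauchyI)
    fix e :: real assume "0 < e"
    then obtain N where N: "\<And>m n. N \<le> m \<Longrightarrow> N \<le> n \<Longrightarrow> dist (sqrt_majorant m) (sqrt_majorant n) < e"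
      using C by (metis metric_CauchyD)
    have "dist (sqrt_iter R m) (sqrt_iter R n) < e" if "N \<le> m" "N \<le> n" for m n
      using le[of n m] le[of m n] N[OF that]
      by (cases "n \<le> m") (auto simp: dist_norm norm_minus_commute)
    then show "\<exists>M. \<forall>m\<ge>M. \<forall>n\<ge>M. dist (sqrt_iter R m) (sqrt_iter R n) < e" by blast
  qed
  then show ?thesis by (rule Cauchy_convergent)
qed

lemma sqrt_iter_commute:
  assumes "S o\<^sub>L R = R o\<^sub>L S"
  shows "S o\<^sub>L sqrt_iter R n = sqrt_iter R n o\<^sub>L S"
proof (induction n)
  case (Suc n)
  then have "S (sqrt_iter R n x) = sqrt_iter R n (S x)" for x
    by (metis blinfun_apply_blinfun_compose)
  then have "S o\<^sub>L (sqrt_iter R n o\<^sub>L sqrt_iter R n) = (sqrt_iter R n o\<^sub>L sqrt_iter R n) o\<^sub>L S"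
    by (intro blinfun_eqI) simp
  then show ?case
    by (simp add: blinfun_compose.scaleR_left blinfun_compose.scaleR_right
        blinfun_compose.add_left blinfun_compose.add_right assms)
qed simp

lemma sqrt_iter_symmetric:
  fixes R :: "'a::{banach,real_inner} \<Rightarrow>\<^sub>L 'a"
  assumes "\<And>x y. inner (R x) y = inner x (R y)"
  shows "inner (sqrt_iter R n x) y = inner x (sqrt_iter R n y)"
proof (induction n arbitrary: x y)
  case (Suc n)
  then show ?case
    by (simp add: blinfun.bilinear_simps inner_simps assms)
qed simp

text \<open>For \<open>K\<close> bounding the norm of \<open>T\<close>, the operator \<open>R = 1 - T/K\<close> lies between \<open>0\<close> and \<open>1\<close> and thus
  is a contraction. If \<open>X\<close> is the limit of its iteration, then \<open>\<surd>K (1 - X)\<close> is a square root of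
  \<open>T\<close>, positive because \<open>\<parallel>X\<parallel> \<le> 1\<close>. The commutation clause serves uniqueness; applied to the
  scalar multiplications it also shows that the root is complex linear, although the iteration runs
  among real-linear maps.\<close>

lemma ex_positive_sqrt:
  assumes T: "positive_op T"
  shows "\<exists>P. positive_op P \<and> P \<circ> P = T \<and>
    (\<forall>S. bounded_linear S \<longrightarrow> S \<circ> T = T \<circ> S \<longrightarrow> S \<circ> P = P \<circ> S)"
proof -
  have bl: "bounded_linear T"
    using T by (intro bounded_clinear_bounded_linear positive_op_bounded_clinear)
  obtain K where K: "\<And>x. norm (T x) \<le> norm x * K" "0 < K"
    using bounded_linear.pos_bounded[OF bl] by blast
  define R where "R = id_blinfun - (1/K) *\<^sub>R Blinfun T"
  have R_apply: "R x = x - (1/K) *\<^sub>R T x" for x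
    by (simp add: R_def blinfun.bilinear_simps bounded_linear_Blinfun_apply[OF bl])
  have R_sym: "inner (R x) y = inner x (R y)" for x y
    by (simp add: R_apply inner_simps positive_op_symmetric[OF T])
  have R_le: "inner (R x) x \<le> (norm x)\<^sup>2" for x
    using positive_op_inner_nonneg[OF T, of x] \<open>0 < K\<close>
    by (simp add: R_apply inner_simps power2_norm_eq_inner)
  have R_nonneg: "0 \<le> inner (R x) x" for x
  proof -
    have "inner (T x) x \<le> norm (T x) * norm x" by (rule norm_cauchy_schwarz)
    also have "\<dots> \<le> K * inner x x"
      using mult_right_mono[OF K(1)[of x], of "norm x"]
      by (simp add: power2_norm_eq_inner[symmetric] power2_eq_square mult_ac)
    finally show ?thesis
      using \<open>0 < K\<close> by (simp add: R_apply inner_simps field_simps)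
  qed
  have "norm (R x) \<le> norm x" for x
  proof (cases "R x = 0")
    case False
    \<comment> \<open>Cauchy-Schwarz for the form of \<open>R\<close> at \<open>x\<close> and \<open>Rx\<close>, followed by \<open>R \<le> 1\<close> in both factors.\<close>
    have "((norm (R x))\<^sup>2)\<^sup>2 \<le> inner (R x) x * inner (R (R x)) (R x)"
      using symmetric_nonneg_cauchy_schwarz[OF bounded_linear.linear[OF blinfun.bounded_linear_right]
          R_sym R_nonneg, of x "R x"]
      by (simp add: power2_norm_eq_inner)
    also have "\<dots> \<le> (norm x)\<^sup>2 * (norm (R x))\<^sup>2"
      by (intro mult_mono R_le R_nonneg) simp
    finally have "(norm (R x))\<^sup>2 \<le> (norm x)\<^sup>2"
      using False by (metis mult_right_le_imp_le power2_eq_square zero_less_norm_iff zero_less_power)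
    then show ?thesis by (rule power2_le_imp_le) simp
  qed simp
  then have R_norm: "norm R \<le> 1"
    by (intro norm_blinfun_bound) simp_all
  obtain X where X: "sqrt_iter R \<longlonglongrightarrow> X"
    using convergent_sqrt_iter[OF R_norm] convergent_def by blast
  have X_norm: "norm X \<le> 1"
    using tendsto_norm[OF X] norm_sqrt_iter[OF R_norm] sqrt_majorant_bounds(2)
    by (intro LIMSEQ_le_const2) (auto intro: order_trans)
  have X_eq: "X = (1/2) *\<^sub>R (R + (X o\<^sub>L X))"
  proof (rule LIMSEQ_unique)
    show "(\<lambda>n. sqrt_iter R (Suc n)) \<longlonglongrightarrow> X" using X by (rule LIMSEQ_Suc)
    show "(\<lambda>n. sqrt_iter R (Suc n)) \<longlonglongrightarrow> (1/2) *\<^sub>R (R + (X o\<^sub>L X))"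
      unfolding sqrt_iter.simps
      by (intro tendsto_intros blinfun_compose.tendsto X)
  qed
  have X_sym: "inner (X x) y = inner x (X y)" for x y
  proof (rule LIMSEQ_unique)
    show "(\<lambda>n. inner (sqrt_iter R n x) y) \<longlonglongrightarrow> inner (X x) y"
      by (intro tendsto_intros blinfun.tendsto X)
    show "(\<lambda>n. inner (sqrt_iter R n x) y) \<longlonglongrightarrow> inner x (X y)"
      unfolding sqrt_iter_symmetric[OF R_sym]
      by (intro tendsto_intros blinfun.tendsto X)
  qed
  have X_commute: "S (X x) = X (S x)" if S: "bounded_linear S" "S \<circ> T = T \<circ> S" for S x
  proof -
    have ST: "S (T y) = T (S y)" for y using S(2) by (metis comp_apply)
    have "Blinfun S o\<^sub>L R = R o\<^sub>L Blinfun S"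
      by (rule blinfun_eqI)
        (simp add: R_apply bounded_linear_Blinfun_apply[OF S(1)] ST
          linear_diff[OF bounded_linear.linear[OF S(1)]]
          linear_scale[OF bounded_linear.linear[OF S(1)]])
    note comm = sqrt_iter_commute[OF this]
    have "Blinfun S o\<^sub>L X = X o\<^sub>L Blinfun S"
    proof (rule LIMSEQ_unique)
      show "(\<lambda>n. Blinfun S o\<^sub>L sqrt_iter R n) \<longlonglongrightarrow> (Blinfun S o\<^sub>L X)"
        by (intro tendsto_intros blinfun_compose.tendsto X)
      show "(\<lambda>n. Blinfun S o\<^sub>L sqrt_iter R n) \<longlonglongrightarrow> (X o\<^sub>L Blinfun S)"
        unfolding comm by (intro tendsto_intros blinfun_compose.tendsto X)
    qed
    from arg_cong[OF this, of "\<lambda>F. F x"] show ?thesis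
      by (simp add: bounded_linear_Blinfun_apply[OF S(1)])
  qed
  define P where "P x = sqrt K *\<^sub>R (x - X x)" for x
  have P_commute: "S (P x) = P (S x)" if "bounded_linear S" "S \<circ> T = T \<circ> S" for S x
    by (simp add: P_def X_commute[OF that] linear_diff[OF bounded_linear.linear[OF that(1)]]
          linear_scale[OF bounded_linear.linear[OF that(1)]])
  have "bounded_linear P"
    unfolding P_def
    by (intro bounded_linear_const_scaleR bounded_linear_sub bounded_linear_ident
        blinfun.bounded_linear_right)
  moreover have "P (c *\<^sub>C x) = c *\<^sub>C P x" for c x
    by (rule P_commute[symmetric, OF bounded_linear_scaleC])
      (auto simp: bounded_clinear_scaleC[OF positive_op_bounded_clinear[OF T]])
  ultimately have "bounded_clinear P" by (simp add: bounded_clinear_def)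
  moreover have "inner (P x) y = inner x (P y)" for x y
    by (simp add: P_def inner_simps X_sym)
  moreover have "0 \<le> inner (P x) x" for x
  proof -
    have "inner (X x) x \<le> norm (X x) * norm x" by (rule norm_cauchy_schwarz)
    also have "\<dots> \<le> (1 * norm x) * norm x"
      using X_norm by (intro mult_right_mono norm_blinfun[THEN order_trans]) simp_all
    finally show ?thesis
      using \<open>0 < K\<close>
      by (simp add: P_def inner_simps power2_norm_eq_inner[symmetric] power2_eq_square)
  qed
  ultimately have "positive_op P" by (rule positive_opI)
  moreover have "P (P x) = T x" for x
  proof -
    have "2 *\<^sub>R X x = R x + X (X x)"
      using arg_cong[OF X_eq, of "\<lambda>F. 2 *\<^sub>R F x"] by (simp add: blinfun.bilinear_simps)
    then have "x - 2 *\<^sub>R X x + X (X x) = x - R x" by simp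
    moreover have "P (P x) = K *\<^sub>R (x - 2 *\<^sub>R X x + X (X x))"
      using \<open>0 < K\<close> by (simp add: P_def blinfun.bilinear_simps algebra_simps scaleR_2)
    ultimately show ?thesis
      using \<open>0 < K\<close> by (simp add: R_apply)
  qed
  ultimately show ?thesis
    using P_commute by (intro exI[of _ P]) (auto simp: fun_eq_iff)
qed

lemma positive_op_zero_if_inner_zero:
  assumes T: "positive_op T" and "inner (T x) x = 0"
  shows "T x = 0"
proof -
  have "(inner (T x) (T x))\<^sup>2 \<le> inner (T x) x * inner (T (T x)) (T x)"
    using T
    by (intro symmetric_nonneg_cauchy_schwarz positive_op_symmetric positive_op_inner_nonneg
        bounded_linear.linear bounded_clinear_bounded_linear positive_op_bounded_clinear)
  then show ?thesis using assms(2) by simp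
qed

text \<open>With \<open>y = Px - Qx\<close>, commutation gives \<open>(P + Q)y = (P\<^sup>2 - Q\<^sup>2)x = 0\<close>. By positivity \<open>Py\<close> and \<open>Qy\<close>
  both vanish, and then \<open>\<parallel>y\<parallel>\<^sup>2 = \<langle>x, (P - Q)y\<rangle> = 0\<close>.\<close>

lemma positive_sqrt_unique_if_commute:
  assumes P: "positive_op P" and Q: "positive_op Q"
    and sq: "P \<circ> P = Q \<circ> Q" and comm: "P \<circ> Q = Q \<circ> P"
  shows "P = Q"
proof
  fix x
  have linP: "linear P" and linQ: "linear Q"
    using P Q by (auto intro: bounded_linear.linear bounded_clinear_bounded_linear
        positive_op_bounded_clinear)
  define y where "y = P x - Q x"
  have "P y + Q y = 0"
    using fun_cong[OF sq, of x] fun_cong[OF comm, of x]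
    by (simp add: y_def linear_diff[OF linP] linear_diff[OF linQ])
  then have "inner (P y) y + inner (Q y) y = 0"
    by (metis inner_add_left inner_zero_left)
  then have "inner (P y) y = 0" "inner (Q y) y = 0"
    using positive_op_inner_nonneg[OF P, of y] positive_op_inner_nonneg[OF Q, of y] by auto
  then have "P y = 0" "Q y = 0"
    using P Q by (auto intro: positive_op_zero_if_inner_zero)
  have "inner y y = inner (P x) y - inner (Q x) y"
    by (subst y_def) (rule inner_diff_left)
  also have "\<dots> = 0"
    by (simp add: positive_op_symmetric[OF P] positive_op_symmetric[OF Q] \<open>P y = 0\<close> \<open>Q y = 0\<close>)
  finally show "P x = Q x" by (simp add: y_def)
qed

lemma positive_op_sqrt:
  assumes T: "positive_op T"
  shows "positive_op (op_sqrt T)"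
proof -
  obtain P where P: "positive_op P" "P \<circ> P = T"
    and comm: "\<And>S. bounded_linear S \<Longrightarrow> S \<circ> T = T \<circ> S \<Longrightarrow> S \<circ> P = P \<circ> S"
    using ex_positive_sqrt[OF T] by blast
  have "\<exists>!P. positive_op P \<and> P \<circ> P = T"
  proof (rule ex1I[of _ P])
    fix Q assume Q: "positive_op Q \<and> Q \<circ> Q = T"
    then have "Q \<circ> P = P \<circ> Q"
      by (intro comm bounded_clinear_bounded_linear positive_op_bounded_clinear)
        (auto simp: o_assoc)
    then show "Q = P"
      using P Q positive_sqrt_unique_if_commute[of Q P] by metis
  qed (use P in auto)
  then have "positive_op (op_sqrt T) \<and> op_sqrt T \<circ> op_sqrt T = T"
    unfolding op_sqrt_def by (rule theI')
  then show ?thesis ..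
qed

lemma positive_op_abs:
  assumes A: "bounded_clinear A"
  shows "positive_op (op_abs A)"
  unfolding op_abs_def
proof (intro positive_op_sqrt positive_opI)
  show "bounded_clinear (hilbert_adjoint A \<circ> A)"
    by (intro bounded_clinear_comp bounded_clinear_hilbert_adjoint A)
  show "inner ((hilbert_adjoint A \<circ> A) x) y = inner x ((hilbert_adjoint A \<circ> A) y)" for x y
    by (simp add: inner_hilbert_adjoint[OF A, symmetric] inner_hilbert_adjoint_left[OF A])
  show "0 \<le> inner ((hilbert_adjoint A \<circ> A) x) x" for x
    by (simp add: inner_hilbert_adjoint_left[OF A])
qed

section \<open>Hyponormality and quasihyponormality through norms\<close>

lemma hyponormal_iff:
  "hyponormal T \<longleftrightarrow> bounded_clinear T \<and> (\<forall>x. norm (hilbert_adjoint T x) \<le> norm (T x))"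
proof (cases "bounded_clinear T")
  case T: True
  note adj = inner_hilbert_adjoint[OF T] inner_hilbert_adjoint_left[OF T]
  have "op_le (T \<circ> hilbert_adjoint T) (hilbert_adjoint T \<circ> T) \<longleftrightarrow>
    (\<forall>x. inner (hilbert_adjoint T x) (hilbert_adjoint T x) \<le> inner (T x) (T x))"
    using T by (subst op_le_iff) (simp_all add: adj bounded_clinear_comp bounded_clinear_hilbert_adjoint)
  then show ?thesis
    using T by (simp add: hyponormal_def norm_le)
qed (simp add: hyponormal_def)

lemma quasihyponormal_iff:
  "quasihyponormal T \<longleftrightarrow>
    bounded_clinear T \<and> (\<forall>x. norm (hilbert_adjoint T (T x)) \<le> norm (T (T x)))"
proof (cases "bounded_clinear T")
  case T: True
  let ?S = "hilbert_adjoint T"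
  note adj = inner_hilbert_adjoint[OF T] inner_hilbert_adjoint_left[OF T]
  have "op_le ((?S \<circ> T) ^^ 2) ((?S ^^ 2) \<circ> (T ^^ 2)) \<longleftrightarrow>
    (\<forall>x. inner (?S (T x)) (?S (T x)) \<le> inner (T (T x)) (T (T x)))"
    using T by (subst op_le_iff)
      (simp_all add: numeral_2_eq_2 adj bounded_clinear_comp bounded_clinear_hilbert_adjoint)
  then show ?thesis
    using T by (simp add: quasihyponormal_def norm_le)
qed (simp add: quasihyponormal_def)

lemma unitary_op_hilbert_adjoint:
  assumes "unitary_op U"
  shows "unitary_op (hilbert_adjoint U)"
  using assms
  by (simp add: unitary_op_def hilbert_adjoint_hilbert_adjoint bounded_clinear_hilbert_adjoint)

lemma unitary_op_cancel:
  assumes "unitary_op U"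
  shows "hilbert_adjoint U (U x) = x" "U (hilbert_adjoint U x) = x"
  using assms by (metis unitary_op_def comp_apply id_apply)+

lemma norm_unitary_op:
  assumes U: "unitary_op U"
  shows "norm (U x) = norm x"
proof -
  have "bounded_clinear U" using U by (simp add: unitary_op_def)
  from inner_hilbert_adjoint[OF this, of x "U x"] show ?thesis
    by (simp add: unitary_op_cancel[OF U] norm_eq_sqrt_inner)
qed

lemma hilbert_adjoint_unitary_conj:
  assumes "unitary_op U" "bounded_clinear T"
  shows "hilbert_adjoint (U \<circ> T \<circ> hilbert_adjoint U) = U \<circ> hilbert_adjoint T \<circ> hilbert_adjoint U"
  using assms
  by (simp add: unitary_op_def hilbert_adjoint_comp bounded_clinear_comp
      bounded_clinear_hilbert_adjoint hilbert_adjoint_hilbert_adjoint o_assoc)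

lemma bounded_clinear_unitary_conj:
  assumes "unitary_op U" "bounded_clinear T"
  shows "bounded_clinear (U \<circ> T \<circ> hilbert_adjoint U)"
  using assms by (simp add: unitary_op_def bounded_clinear_comp bounded_clinear_hilbert_adjoint)

lemma hyponormal_unitary_conj:
  assumes U: "unitary_op U" and T: "hyponormal T"
  shows "hyponormal (U \<circ> T \<circ> hilbert_adjoint U)"
  using T unfolding hyponormal_iff
  by (simp add: hilbert_adjoint_unitary_conj[OF U] norm_unitary_op[OF U]
      bounded_clinear_unitary_conj[OF U])

lemma quasihyponormal_unitary_conj:
  assumes U: "unitary_op U" and T: "quasihyponormal T"
  shows "quasihyponormal (U \<circ> T \<circ> hilbert_adjoint U)"
  using T unfolding quasihyponormal_iff
  by (simp add: hilbert_adjoint_unitary_conj[OF U] norm_unitary_op[OF U]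
      bounded_clinear_unitary_conj[OF U] unitary_op_cancel[OF U])

section \<open>Multiplication by a commuting positive operator\<close>

text \<open>Take adjoints of both sides of \<open>PC = CP\<close>.\<close>

lemma positive_op_commute_hilbert_adjoint:
  assumes P: "positive_op P" and C: "bounded_clinear C" and comm: "P \<circ> C = C \<circ> P"
  shows "P \<circ> hilbert_adjoint C = hilbert_adjoint C \<circ> P"
  using arg_cong[OF comm, of hilbert_adjoint] P C
  by (simp add: hilbert_adjoint_comp hilbert_adjoint_positive positive_op_bounded_clinear)

text \<open>With \<open>D = CP\<close>, commutation gives \<open>D\<^sup>* = C\<^sup>*P\<close>, so the inequality for \<open>C\<close> at \<open>Px\<close> is the one
  required.\<close>

lemma hyponormal_positive_comp:
  assumes P: "positive_op P" and C: "hyponormal C" and comm: "P \<circ> C = C \<circ> P"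
  shows "hyponormal (C \<circ> P)"
proof -
  have lin: "bounded_clinear C" "bounded_clinear P"
    using C P by (auto simp: hyponormal_def positive_op_bounded_clinear)
  have "hilbert_adjoint (C \<circ> P) = hilbert_adjoint C \<circ> P"
    using positive_op_commute_hilbert_adjoint[OF P lin(1) comm]
    by (simp add: hilbert_adjoint_comp lin hilbert_adjoint_positive[OF P])
  then show ?thesis
    using C by (simp add: hyponormal_iff lin bounded_clinear_comp)
qed

text \<open>With \<open>D = CP\<close>, commutation gives \<open>D\<^sup>*D = C\<^sup>*CP\<^sup>2\<close> and \<open>D\<^sup>2 = C\<^sup>2P\<^sup>2\<close>, so the inequality for \<open>C\<close> at
  \<open>P\<^sup>2x\<close> is the one required.\<close>

lemma quasihyponormal_positive_comp:
  assumes P: "positive_op P" and C: "quasihyponormal C" and comm: "P \<circ> C = C \<circ> P"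
  shows "quasihyponormal (C \<circ> P)"
proof -
  have lin: "bounded_clinear C" "bounded_clinear P"
    using C P by (auto simp: quasihyponormal_def positive_op_bounded_clinear)
  have adj: "hilbert_adjoint (C \<circ> P) = hilbert_adjoint C \<circ> P"
    using positive_op_commute_hilbert_adjoint[OF P lin(1) comm]
    by (simp add: hilbert_adjoint_comp lin hilbert_adjoint_positive[OF P])
  have "P (C x) = C (P x)" for x using comm by (metis comp_apply)
  then show ?thesis
    using C by (simp add: quasihyponormal_iff lin bounded_clinear_comp adj)
qed

theorem proposition2p1:
  fixes A B U :: "'a::chilbert_space \<Rightarrow> 'a"
  assumes "bounded_clinear A"
    and "bounded_clinear B"
    and "unitary_op U"
    and "A = U \<circ> op_abs A"
    and "op_abs A \<circ> B \<circ> U = B \<circ> U \<circ> op_abs A"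
  shows "(hyponormal (U \<circ> B) \<longrightarrow> hyponormal (A \<circ> B)) \<and>
         (hyponormal (B \<circ> U) \<longrightarrow> hyponormal (B \<circ> A)) \<and>
         (quasihyponormal (U \<circ> B) \<longrightarrow> quasihyponormal (A \<circ> B)) \<and>
         (quasihyponormal (B \<circ> U) \<longrightarrow> quasihyponormal (B \<circ> A))"
proof -
  let ?V = "hilbert_adjoint U"
  define P where "P = op_abs A"
  define C where "C = B \<circ> U"
  have P: "positive_op P"
    unfolding P_def by (rule positive_op_abs) (rule assms(1))
  have comm: "P \<circ> C = C \<circ> P"
    using assms(5) by (simp add: P_def C_def o_assoc)
  note U = \<open>unitary_op U\<close>
  note V = unitary_op_hilbert_adjoint[OF U]
  have VV: "hilbert_adjoint ?V = U"
    using U by (simp add: unitary_op_def hilbert_adjoint_hilbert_adjoint)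
  have A: "A x = U (P x)" for x
    using fun_cong[OF assms(4), of x] by (simp add: P_def)
  have BA: "B \<circ> A = C \<circ> P"
    by (auto simp: A C_def)
  have AB: "A \<circ> B = U \<circ> (C \<circ> P) \<circ> ?V"
    unfolding comm[symmetric] by (auto simp: A C_def unitary_op_cancel[OF U])
  have C_conj: "C = ?V \<circ> (U \<circ> B) \<circ> hilbert_adjoint ?V"
    by (auto simp: C_def unitary_op_cancel[OF U] VV)
  have C_if_UB: "hyponormal C" if "hyponormal (U \<circ> B)"
    using hyponormal_unitary_conj[OF V that] by (simp only: C_conj[symmetric])
  have quasi_C_if_UB: "quasihyponormal C" if "quasihyponormal (U \<circ> B)"
    using quasihyponormal_unitary_conj[OF V that] by (simp only: C_conj[symmetric])
  show ?thesis
    unfolding AB BA C_def[symmetric]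
    using hyponormal_positive_comp[OF P _ comm] quasihyponormal_positive_comp[OF P _ comm]
      hyponormal_unitary_conj[OF U, of "C \<circ> P"] quasihyponormal_unitary_conj[OF U, of "C \<circ> P"]
      C_if_UB quasi_C_if_UB
    by blast
qed

end
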